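(* Let $p>3$ be a prime, $e\in\{3,4,6\}$ with $e\mid p+1$, $k\ge1$, and $\alpha\in\mathbb{P}^1(\mathbb{Q}_p)$ with $v(\alpha^{-1})\ge\max\{0,k-1\}$. Let $$g_k(x)=x^{p^{2k}}+\sum_{n=1}^k(-1)^np^n\big(x^{p^{2k-2n}}+\alpha^{-1}\pi_e^2x^{p^{2k+1-2n}}\big),\qquad g_k^\infty(x)=\sum_{n=0}^k(-1)^np^nx^{p^{2k-2n}}.$$ Then the splitting fields of $g_k$ and $g_k^\infty$ over $K$ coincide.
   Context: $v$ is the $p$-adic valuation with $v(p)=1$; $\pi_e\in\overline{\mathbb{Q}}_p$ is a fixed root of $x^e+p$, $\zeta_e$ a primitive $e$-th root of unity, $K=\mathbb{Q}_p(\pi_e,\zeta_e)$; convention $\alpha^{-1}=0$ if $\alpha=\infty$. *)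

theory Defs
  imports "HOL-Computational_Algebra.Polynomial" "HOL-Library.Extended_Real"
begin

definition is_subfield :: "'a::field set \<Rightarrow> bool" where
  "is_subfield F \<longleftrightarrow> 0 \<in> F \<and> 1 \<in> F \<and>
     (\<forall>x\<in>F. \<forall>y\<in>F. x + y \<in> F \<and> x * y \<in> F) \<and>
     (\<forall>x\<in>F. - x \<in> F \<and> inverse x \<in> F)"

definition gen_field :: "'a::field set \<Rightarrow> 'a set" where
  "gen_field S = \<Inter> {F. is_subfield F \<and> S \<subseteq> F}"

definition splitting_field_over :: "'a::field set \<Rightarrow> 'a poly \<Rightarrow> 'a set" where
  "splitting_field_over K g = gen_field (K \<union> {x. poly g x = 0})"

definition is_valuation :: "('a::field \<Rightarrow> ereal) \<Rightarrow> bool" where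
  "is_valuation v \<longleftrightarrow> (\<forall>x. v x = \<infinity> \<longleftrightarrow> x = 0) \<and> (\<forall>x. v x \<noteq> -\<infinity>) \<and>
     (\<forall>x y. v (x * y) = v x + v y) \<and> (\<forall>x y. v (x + y) \<ge> min (v x) (v y))"

definition v_cauchy :: "('a::field \<Rightarrow> ereal) \<Rightarrow> (nat \<Rightarrow> 'a) \<Rightarrow> bool" where
  "v_cauchy v X \<longleftrightarrow> (\<forall>N::real. \<exists>M. \<forall>m\<ge>M. \<forall>n\<ge>M. v (X m - X n) \<ge> ereal N)"

definition v_converges_to :: "('a::field \<Rightarrow> ereal) \<Rightarrow> (nat \<Rightarrow> 'a) \<Rightarrow> 'a \<Rightarrow> bool" where
  "v_converges_to v X L \<longleftrightarrow> (\<forall>N::real. \<exists>M. \<forall>n\<ge>M. v (X n - L) \<ge> ereal N)"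

text \<open>The ambient field 'a, with valuation v and subfield Qp, is an algebraic closure
  of the p-adic numbers: Qp is a subfield, complete for v, in which the rationals are
  v-dense; v(p) = 1 (so v restricted to the rationals is the normalized p-adic valuation,
  by Ostrowski); 'a is algebraically closed and algebraic over Qp.\<close>
definition padic_closure :: "nat \<Rightarrow> ('a::field_char_0 \<Rightarrow> ereal) \<Rightarrow> 'a set \<Rightarrow> bool" where
  "padic_closure p v Qp \<longleftrightarrow>
     is_valuation v \<and> v (of_nat p) = 1 \<and> is_subfield Qp \<and>
     (\<forall>X. (\<forall>n. X n \<in> Qp) \<and> v_cauchy v X \<longrightarrow> (\<exists>L\<in>Qp. v_converges_to v X L)) \<and>
     (\<forall>x\<in>Qp. \<forall>N::real. \<exists>q::rat. v (x - of_rat q) \<ge> ereal N) \<and>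
     (\<forall>q::'a poly. degree q > 0 \<longrightarrow> (\<exists>x. poly q x = 0)) \<and>
     (\<forall>x. \<exists>q::'a poly. q \<noteq> 0 \<and> (\<forall>i. coeff q i \<in> Qp) \<and> poly q x = 0)"

definition primitive_root_of_unity :: "nat \<Rightarrow> 'a::field \<Rightarrow> bool" where
  "primitive_root_of_unity e z \<longleftrightarrow> z ^ e = 1 \<and> (\<forall>j. 0 < j \<and> j < e \<longrightarrow> z ^ j \<noteq> 1)"

text \<open>alpha in P^1(Q_p): None is \<infinity>; its inverse with the convention \<infinity>^{-1} = 0.\<close>
definition inv_P1 :: "'a::field option \<Rightarrow> 'a" where
  "inv_P1 \<alpha> = (case \<alpha> of None \<Rightarrow> 0 | Some a \<Rightarrow> inverse a)"

definition g_poly :: "nat \<Rightarrow> nat \<Rightarrow> 'a \<Rightarrow> 'a \<Rightarrow> 'a::field poly" where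
  "g_poly p k ainv \<pi> = monom 1 (p ^ (2*k)) +
     (\<Sum>n=1..k. smult ((-1) ^ n * of_nat p ^ n)
        (monom 1 (p ^ (2*k - 2*n)) + smult (ainv * \<pi>^2) (monom 1 (p ^ (2*k + 1 - 2*n)))))"

definition g_inf_poly :: "nat \<Rightarrow> nat \<Rightarrow> 'a::field poly" where
  "g_inf_poly p k = (\<Sum>n=0..k. smult ((-1) ^ n * of_nat p ^ n) (monom 1 (p ^ (2*k - 2*n))))"

end

(* The polynomial g_k^infinity is g_k with alpha^-1 replaced by 0, so it suffices to compare
   g_a and g_b for two parameters a, b in Q_p of valuation at least k - 1.  On integral points
   at distance of valuation at least 1/3 the map phi_a(x) = x - g_a(x) / (-p)^k gains 1 in
   valuation, because v(x^p - y^p) >= v(x - y) + 1 there (p > 3).  A root y of g_b satisfies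
   v(g_a(y)) >= k + v(pi^2) >= k + 1/3 (v(pi^2) = 2/e), so iterating phi_a from y converges to a
   root of g_a; the limit lies in Q_p[pi, y], which is complete as a finitely generated Q_p-module.
   By uniqueness of fixed points in such a ball, every root of g_a arises from some root of g_b. *)
theory Submission
  imports Defs "HOL-Computational_Algebra.Primes"
begin

section \<open>Subrings and finitely generated modules\<close>

text \<open>Rings suffice for the iteration: the only division it performs is by a power of p, up to
  sign, whose inverse already lies in the base field.\<close>

definition is_subring :: "'a::field set \<Rightarrow> bool" where
  "is_subring R \<longleftrightarrow> 0 \<in> R \<and> 1 \<in> R \<and>
     (\<forall>x\<in>R. \<forall>y\<in>R. x + y \<in> R \<and> x * y \<in> R) \<and> (\<forall>x\<in>R. - x \<in> R)"

lemma is_subring_subfield: "is_subfield F \<Longrightarrow> is_subring F"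
  by (auto simp: is_subfield_def is_subring_def)

context
  fixes R :: "'a::field set"
  assumes R: "is_subring R"
begin

lemma subring_0: "0 \<in> R" and subring_1: "1 \<in> R"
  and subring_add: "x \<in> R \<Longrightarrow> y \<in> R \<Longrightarrow> x + y \<in> R"
  and subring_mult: "x \<in> R \<Longrightarrow> y \<in> R \<Longrightarrow> x * y \<in> R"
  and subring_uminus: "x \<in> R \<Longrightarrow> - x \<in> R"
  using R by (auto simp: is_subring_def)

lemma subring_diff: "x \<in> R \<Longrightarrow> y \<in> R \<Longrightarrow> x - y \<in> R"
  using subring_add[of x "- y"] subring_uminus[of y] by simp

lemma subring_sum: "(\<And>i. i \<in> A \<Longrightarrow> f i \<in> R) \<Longrightarrow> sum f A \<in> R"
  by (induction A rule: infinite_finite_induct) (auto intro: subring_0 subring_add)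

lemma subring_power: "x \<in> R \<Longrightarrow> x ^ n \<in> R"
  by (induction n) (auto intro: subring_1 subring_mult)

lemma subring_of_nat: "of_nat n \<in> R"
  by (induction n) (auto intro: subring_0 subring_1 subring_add)

lemma subring_poly: "(\<And>i. coeff f i \<in> R) \<Longrightarrow> x \<in> R \<Longrightarrow> poly f x \<in> R"
  by (simp add: poly_altdef subring_sum subring_mult subring_power)

end

section \<open>Adjoining an element and finite generation of the resulting ring\<close>

definition adjoin :: "'a::field set \<Rightarrow> 'a \<Rightarrow> 'a set" where
  "adjoin R y = {poly f y | f. \<forall>i. coeff f i \<in> R}"

lemma is_subring_adjoin:
  assumes R: "is_subring R"
  shows "is_subring (adjoin R y)"
proof -
  have cl: "poly f y + poly g y \<in> adjoin R y" "poly f y * poly g y \<in> adjoin R y"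
      "- poly f y \<in> adjoin R y"
    if "\<forall>i. coeff f i \<in> R" "\<forall>i. coeff g i \<in> R" for f g
  proof -
    show "poly f y + poly g y \<in> adjoin R y"
      unfolding adjoin_def using that subring_add[OF R]
      by (intro CollectI exI[of _ "f + g"]) auto
    show "poly f y * poly g y \<in> adjoin R y"
      unfolding adjoin_def using that
      by (intro CollectI exI[of _ "f * g"])
        (auto simp: coeff_mult intro!: subring_sum[OF R] subring_mult[OF R])
    show "- poly f y \<in> adjoin R y"
      unfolding adjoin_def using that subring_uminus[OF R]
      by (intro CollectI exI[of _ "- f"]) auto
  qed
  have "0 \<in> adjoin R y"
    unfolding adjoin_def using subring_0[OF R] by (intro CollectI exI[of _ 0]) auto
  moreover have "1 \<in> adjoin R y"
    unfolding adjoin_def using subring_0[OF R] subring_1[OF R]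
    by (intro CollectI exI[of _ 1]) auto
  ultimately show ?thesis
    unfolding is_subring_def using cl by (auto simp: adjoin_def)
qed

lemma subset_adjoin:
  assumes "is_subring R"
  shows "R \<subseteq> adjoin R y"
proof
  fix x assume "x \<in> R"
  then show "x \<in> adjoin R y"
    unfolding adjoin_def using subring_0[OF assms]
    by (intro CollectI exI[of _ "[:x:]"]) (auto simp: coeff_pCons split: nat.split)
qed

lemma in_adjoin:
  assumes "is_subring R"
  shows "y \<in> adjoin R y"
  unfolding adjoin_def using subring_0[OF assms] subring_1[OF assms]
  by (intro CollectI exI[of _ "[:0, 1:]"]) (auto simp: coeff_pCons split: nat.split)

lemma adjoin_subset:
  assumes "is_subring S" "R \<subseteq> S" "y \<in> S"
  shows "adjoin R y \<subseteq> S"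
  using subring_poly[OF assms(1)] assms(2,3) by (auto simp: adjoin_def)

text \<open>The modules \<open>F b1 + ... + F bn\<close>, built one generator at a time. No
  independence of the generators is demanded, so no basis has to be chosen, and completeness can be
  proved by induction on the construction.\<close>

inductive fin_gen :: "'a::field set \<Rightarrow> 'a set \<Rightarrow> bool" for F where
  fin_gen_zero: "fin_gen F {0}"
| fin_gen_insert: "fin_gen F V \<Longrightarrow> fin_gen F {w + c * b | w c. w \<in> V \<and> c \<in> F}"

lemma fin_gen_diff:
  assumes "fin_gen F V" and F: "is_subring F" and "x \<in> V" "y \<in> V"
  shows "x - y \<in> V"
  using assms(1,3,4)
proof (induction arbitrary: x y)
  case (fin_gen_insert V b)
  then obtain w c w' c' where "x = w + c * b" "y = w' + c' * b" "w \<in> V" "w' \<in> V" "c \<in> F" "c' \<in> F"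
    by blast
  moreover have "x - y = (w - w') + (c - c') * b"
    using calculation by (simp add: algebra_simps)
  ultimately show ?case
    using fin_gen_insert.IH subring_diff[OF F] by blast
qed auto

lemma fin_gen_scale:
  assumes "fin_gen F V" and F: "is_subring F" and "x \<in> V" "c \<in> F"
  shows "c * x \<in> V"
  using assms(1,3)
proof (induction arbitrary: x)
  case (fin_gen_insert V b)
  then obtain w c' where "x = w + c' * b" "w \<in> V" "c' \<in> F"
    by blast
  moreover have "c * x = c * w + (c * c') * b"
    using calculation by (simp add: algebra_simps)
  ultimately show ?case
    using fin_gen_insert.IH subring_mult[OF F] \<open>c \<in> F\<close> by blast
qed auto

lemma fin_gen_self: "fin_gen F F"
  using fin_gen_insert[OF fin_gen_zero, of F 1] by simp

lemma fin_gen_plus: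
  assumes "fin_gen F U" "fin_gen F V"
  shows "fin_gen F {u + w | u w. u \<in> U \<and> w \<in> V}"
  using assms(2)
proof induction
  case fin_gen_zero
  then show ?case using assms(1) by simp
next
  case (fin_gen_insert V b)
  have "{u + w | u w. u \<in> U \<and> w \<in> {w + c * b | w c. w \<in> V \<and> c \<in> F}} =
      {w + c * b | w c. w \<in> {u + w | u w. u \<in> U \<and> w \<in> V} \<and> c \<in> F}"
    by (auto simp: add.assoc) (metis add.assoc)+
  then show ?case
    using fin_gen.fin_gen_insert[OF fin_gen_insert.IH, of b] by simp
qed

lemma fin_gen_times:
  assumes "fin_gen F V"
  shows "fin_gen F ((\<lambda>x. x * d) ` V)"
  using assms
proof induction
  case fin_gen_zero
  then show ?case using fin_gen.fin_gen_zero by simp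
next
  case (fin_gen_insert V b)
  have "(\<lambda>x. x * d) ` {w + c * b | w c. w \<in> V \<and> c \<in> F} =
      {w + c * (b * d) | w c. w \<in> (\<lambda>x. x * d) ` V \<and> c \<in> F}"
    (is "?L = ?R")
  proof
    show "?L \<subseteq> ?R"
    proof
      fix x assume "x \<in> ?L"
      then obtain w c where "x = w * d + c * (b * d)" "w \<in> V" "c \<in> F"
        by (auto simp: distrib_right mult.assoc)
      then show "x \<in> ?R" by blast
    qed
    show "?R \<subseteq> ?L"
    proof
      fix x assume "x \<in> ?R"
      then obtain w c where wc: "x = (w + c * b) * d" "w \<in> V" "c \<in> F"
        by (auto simp: distrib_right mult.assoc)
      then show "x \<in> ?L" by blast
    qed
  qed
  then show ?case
    using fin_gen.fin_gen_insert[OF fin_gen_insert.IH, of "b * d"] by simp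
qed

text \<open>The relation \<open>y ^ D = poly r y\<close>, with \<open>r\<close> of degree below
  \<open>D\<close>, rewrites every higher power of \<open>y\<close>. Hence R[y] is the sum of the
  modules \<open>R y^i\<close> for \<open>i < D\<close>, each of them finitely generated over
  \<open>F\<close>.\<close>

lemma fin_gen_adjoin:
  assumes R: "is_subring R" and fg: "fin_gen F R"
    and r: "\<And>i. coeff r i \<in> R" "\<And>i. i \<ge> D \<Longrightarrow> coeff r i = 0" and y: "y ^ D = poly r y"
  shows "fin_gen F (adjoin R y)"
proof -
  \<comment> \<open>\<open>S n\<close> collects the values at \<open>y\<close> of the polynomials
    over \<open>R\<close> of degree below \<open>n\<close>; it grows by \<open>R y^n\<close> at each
    step.\<close>
  define S where "S n = {poly f y | f. (\<forall>i. coeff f i \<in> R) \<and> (\<forall>i\<ge>n. coeff f i = 0)}" for n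
  have S0: "S 0 = {0}"
  proof -
    have "S 0 \<subseteq> {0}"
    proof
      fix x assume "x \<in> S 0"
      then obtain f where "x = poly f y" "\<forall>i. coeff f i = 0" by (auto simp: S_def)
      moreover from this have "f = 0" by (intro poly_eqI) simp
      ultimately show "x \<in> {0}" by simp
    qed
    moreover have "0 \<in> S 0"
      unfolding S_def using subring_0[OF R] by (intro CollectI exI[of _ 0]) auto
    ultimately show ?thesis by blast
  qed
  have SS: "S (Suc n) = {u + w | u w. u \<in> S n \<and> w \<in> (\<lambda>x. x * y ^ n) ` R}" (is "_ = ?T") for n
  proof
    show "S (Suc n) \<subseteq> ?T"
    proof
      fix x assume "x \<in> S (Suc n)"
      then obtain f where f: "x = poly f y" "\<forall>i. coeff f i \<in> R" "\<forall>i\<ge>Suc n. coeff f i = 0"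
        by (auto simp: S_def)
      have "poly (f - monom (coeff f n) n) y \<in> S n"
        unfolding S_def
      proof (intro CollectI exI conjI)
        show "\<forall>i. coeff (f - monom (coeff f n) n) i \<in> R"
          using f(2) subring_0[OF R] by simp
        show "\<forall>i\<ge>n. coeff (f - monom (coeff f n) n) i = 0"
          using f(3) by (auto simp: not_less_eq_eq[symmetric] Suc_le_eq)
      qed simp
      moreover have "x = poly (f - monom (coeff f n) n) y + coeff f n * y ^ n"
        by (simp add: f(1) poly_monom)
      ultimately show "x \<in> ?T" using f(2) by blast
    qed
    show "?T \<subseteq> S (Suc n)"
    proof
      fix x assume "x \<in> ?T"
      then obtain f c where f: "x = poly f y + c * y ^ n" "\<forall>i. coeff f i \<in> R"
          "\<forall>i\<ge>n. coeff f i = 0" "c \<in> R"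
        by (auto simp: S_def)
      then show "x \<in> S (Suc n)"
        unfolding S_def using subring_add[OF R]
        by (intro CollectI exI[of _ "f + monom c n"]) (auto simp: poly_monom)
    qed
  qed
  have fgS: "fin_gen F (S n)" for n
    by (induction n) (simp_all add: S0 SS fin_gen_zero fin_gen_plus fin_gen_times fg)
  have reduce: "poly f y \<in> S D" if "\<And>i. coeff f i \<in> R" "\<And>i. i \<ge> n \<Longrightarrow> coeff f i = 0" for n f
    using that
  proof (induction n arbitrary: f)
    case 0
    then show ?case unfolding S_def by auto
  next
    case (Suc n)
    show ?case
    proof (cases "Suc n \<le> D")
      case True
      then show ?thesis using Suc.prems unfolding S_def by auto
    next
      case False
      define c where "c = coeff f n"
      \<comment> \<open>The top term \<open>c x^n\<close> is traded for \<open>c x^(n-D) r\<close>,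
        which has the same value at \<open>y\<close> but degree below \<open>n\<close>.\<close>
      define f' where "f' = f - monom c n + monom c (n - D) * r"
      have "y ^ n = y ^ (n - D) * poly r y"
        using False by (simp flip: y power_add)
      then have "poly f' y = poly f y"
        by (simp add: f'_def poly_monom)
      moreover have "poly f' y \<in> S D"
      proof (rule Suc.IH)
        show "coeff f' i \<in> R" for i
          using Suc.prems(1) r(1) subring_0[OF R]
          by (auto simp: f'_def c_def coeff_monom_mult intro!: subring_add[OF R] subring_mult[OF R])
        show "coeff f' i = 0" if "i \<ge> n" for i
          using that r(2)[of "i - (n - D)"] Suc.prems(2)[of i] False
          by (cases "i = n") (auto simp: f'_def c_def coeff_monom_mult)
      qed
      ultimately show ?thesis by simp
    qed
  qed
  have "adjoin R y = S D"
  proof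
    show "adjoin R y \<subseteq> S D"
    proof
      fix x assume "x \<in> adjoin R y"
      then obtain f where "x = poly f y" "\<And>i. coeff f i \<in> R" by (auto simp: adjoin_def)
      then show "x \<in> S D"
        using reduce[of f "Suc (degree f)"] by (simp add: coeff_eq_0)
    qed
    show "S D \<subseteq> adjoin R y" by (auto simp: S_def adjoin_def)
  qed
  then show ?thesis using fgS by simp
qed

section \<open>Valuations\<close>

locale valued =
  fixes v :: "'a::field \<Rightarrow> ereal"
  assumes val: "is_valuation v"
begin

lemma v_eq_inf: "v x = \<infinity> \<longleftrightarrow> x = 0" and v_neq_minf: "v x \<noteq> -\<infinity>"
  and v_mult: "v (x * y) = v x + v y" and v_add: "v (x + y) \<ge> min (v x) (v y)"
  using val by (auto simp: is_valuation_def)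

lemma v_0: "v 0 = \<infinity>"
  by (simp add: v_eq_inf)

lemma v_real: "x \<noteq> 0 \<Longrightarrow> \<exists>r. v x = ereal r"
  using v_eq_inf[of x] v_neq_minf[of x] by (cases "v x") auto

lemma v_1: "v 1 = 0"
  using v_mult[of 1 1] v_real[of 1] by auto

lemma v_minus_1: "v (-1) = 0"
  using v_mult[of "-1" "-1"] v_1 v_real[of "-1"] by (auto simp: zero_ereal_def)

lemma v_minus: "v (- x) = v x"
  using v_mult[of "-1" x] v_minus_1 by simp

lemma v_diff_commute: "v (x - y) = v (y - x)"
  using v_minus[of "x - y"] by simp

lemma v_ge_add: "r \<le> v x \<Longrightarrow> r \<le> v y \<Longrightarrow> r \<le> v (x + y)"
  using v_add[of x y] by (meson min.boundedI order_trans)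

lemma v_ge_diff: "r \<le> v x \<Longrightarrow> r \<le> v y \<Longrightarrow> r \<le> v (x - y)"
  using v_ge_add[of r x "- y"] by (simp add: v_minus)

lemma v_ge_trans: "r \<le> v (x - y) \<Longrightarrow> r \<le> v (y - z) \<Longrightarrow> r \<le> v (x - z)"
  using v_ge_add[of r "x - y" "y - z"] by simp

lemma v_ge_sum: "(\<And>i. i \<in> A \<Longrightarrow> r \<le> v (f i)) \<Longrightarrow> r \<le> v (sum f A)"
  by (induction A rule: infinite_finite_induct) (auto simp: v_0 intro!: v_ge_add)

lemma v_ge_mult: "ereal r \<le> v x \<Longrightarrow> ereal s \<le> v y \<Longrightarrow> ereal (r + s) \<le> v (x * y)"
  using add_mono[of "ereal r" "v x" "ereal s" "v y"] by (simp add: v_mult)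

lemma v_ge_power: "ereal r \<le> v x \<Longrightarrow> ereal (real n * r) \<le> v (x ^ n)"
proof (induction n)
  case 0
  then show ?case by (simp add: v_1 flip: zero_ereal_def)
next
  case (Suc n)
  then show ?case using v_ge_mult[of r x "real n * r" "x ^ n"] by (simp add: algebra_simps)
qed

lemma v_ge_power0: "0 \<le> v x \<Longrightarrow> 0 \<le> v (x ^ n)"
  using v_ge_power[of 0 x n] by (simp flip: zero_ereal_def)

lemma v_ge_mult0: "r \<le> v x \<Longrightarrow> 0 \<le> v y \<Longrightarrow> r \<le> v (x * y)"
  using add_mono[of r "v x" 0 "v y"] by (simp add: v_mult)

lemma v_of_nat: "0 \<le> v (of_nat n)"
  by (induction n) (auto simp: v_0 v_1 intro!: v_ge_add)

lemma v_inverse: "v x = ereal r \<Longrightarrow> v (inverse x) = ereal (- r)"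
  using v_mult[of x "inverse x"] v_real[of "inverse x"] v_0
  by (cases "x = 0") (auto simp: v_1 zero_ereal_def)

lemma v_power: "v x = ereal r \<Longrightarrow> v (x ^ n) = ereal (real n * r)"
  by (induction n) (auto simp: v_1 v_mult algebra_simps zero_ereal_def)

lemma v_unbounded_imp_zero: "(\<And>N::nat. ereal (real N) \<le> v x) \<Longrightarrow> x = 0"
  using v_real[of x] by (metis ereal_less_eq(3) linorder_not_le reals_Archimedean2)

section \<open>Completeness of finitely generated modules and fixed points of contractions\<close>

definition complete_on :: "'a set \<Rightarrow> bool" where
  "complete_on V \<longleftrightarrow>
     (\<forall>X. (\<forall>n. X n \<in> V) \<and> v_cauchy v X \<longrightarrow> (\<exists>L\<in>V. v_converges_to v X L))"

text \<open>If \<open>b\<close> lies outside a complete module \<open>V\<close>, it has bounded distance from \<open>V\<close>, so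
  the coefficient of \<open>b\<close> in an element of \<open>V + F b\<close> is controlled by the size of that element.\<close>
lemma complete_on_insert:
  assumes F: "is_subfield F" "complete_on F" and V: "fin_gen F V" "complete_on V"
  shows "complete_on {w + c * b | w c. w \<in> V \<and> c \<in> F}"
proof (cases "b \<in> V")
  case True
  have "0 \<in> F" using F(1) by (simp add: is_subfield_def)
  have "w + c * b \<in> V" if "w \<in> V" "c \<in> F" for w c
    using fin_gen_diff[OF V(1) is_subring_subfield[OF F(1)], of w "(- c) * b"] that
      fin_gen_scale[OF V(1) is_subring_subfield[OF F(1)] True, of "- c"] F(1)
    by (simp add: is_subfield_def)
  moreover have "\<exists>w' c. w = w' + c * b \<and> w' \<in> V \<and> c \<in> F" if "w \<in> V" for w
    using that \<open>0 \<in> F\<close> by (intro exI[of _ w] exI[of _ 0]) simp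
  ultimately have "{w + c * b | w c. w \<in> V \<and> c \<in> F} = V"
    by blast
  then show ?thesis using V(2) by simp
next
  case False
  note R = is_subring_subfield[OF F(1)]
  \<comment> \<open>Otherwise elements of \<open>V\<close> would approximate \<open>b\<close>
    arbitrarily well, and completeness of \<open>V\<close> would force \<open>b\<close> into
    \<open>V\<close>.\<close>
  have "\<exists>N::real. \<forall>w\<in>V. v (b - w) < ereal N"
  proof (rule ccontr)
    assume "\<not> ?thesis"
    then have "\<forall>N::nat. \<exists>w\<in>V. ereal (real N) \<le> v (b - w)"
      by (metis not_less)
    then obtain W where W: "\<And>N. W N \<in> V" "\<And>N. ereal (real N) \<le> v (b - W N)"
      by metis
    have W_ge: "ereal N \<le> v (b - W n)" if "nat \<lceil>N\<rceil> \<le> n" for N n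
      using W(2)[of n] that by (meson ereal_less_eq(3) nat_ceiling_le_eq order_trans)
    have "v_cauchy v W"
      unfolding v_cauchy_def using W_ge v_diff_commute v_ge_trans by metis
    then obtain L where L: "L \<in> V" "v_converges_to v W L"
      using V(2) W(1) unfolding complete_on_def by blast
    have "ereal (real N) \<le> v (b - L)" for N
    proof -
      obtain M where "\<And>n. n \<ge> M \<Longrightarrow> ereal (real N) \<le> v (W n - L)"
        using L(2) unfolding v_converges_to_def by blast
      then have "ereal (real N) \<le> v (W (max M N) - L)" "ereal (real N) \<le> v (b - W (max M N))"
        using W_ge[of "real N" "max M N"] by auto
      then show ?thesis using v_ge_trans by blast
    qed
    then have "b = L" using v_unbounded_imp_zero[of "b - L"] by simp
    then show False using L(1) False by simp
  qed
  then obtain N where N: "\<And>w. w \<in> V \<Longrightarrow> v (b - w) < ereal N" by blast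
  have coeff_ge: "ereal (r - N) \<le> v c" if "ereal r \<le> v (w + c * b)" "w \<in> V" "c \<in> F" for r w c
  proof (cases "c = 0")
    case False
    then obtain s where s: "v c = ereal s" using v_real by blast
    \<comment> \<open>Factoring out \<open>c\<close> turns \<open>w + c * b\<close> into
      \<open>c\<close> times the difference of \<open>b\<close> and an element of \<open>V\<close>,
      to which the bound \<open>N\<close> applies. This is where \<open>F\<close> has to be a
      field.\<close>
    have "- inverse c \<in> F" using F(1) \<open>c \<in> F\<close> by (simp add: is_subfield_def)
    then have "v (b - (- inverse c) * w) < ereal N"
      using N fin_gen_scale[OF V(1) R \<open>w \<in> V\<close>] by blast
    moreover have "w + c * b = c * (b - (- inverse c) * w)"
      using False by (simp add: field_simps)
    ultimately have "v (w + c * b) \<le> ereal s + ereal N"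
      by (metis s v_mult add_left_mono less_imp_le)
    then show ?thesis using that(1) s
      by (metis diff_le_eq ereal_less_eq(3) order_trans plus_ereal.simps(1))
  qed (simp add: v_0)
  show ?thesis unfolding complete_on_def
  proof (intro allI impI, elim conjE)
    fix X assume "\<forall>n. X n \<in> {w + c * b | w c. w \<in> V \<and> c \<in> F}" and X: "v_cauchy v X"
    then obtain w c where wc: "\<And>n. X n = w n + c n * b" "\<And>n. w n \<in> V" "\<And>n. c n \<in> F"
      by (simp add: choice_iff) metis
    obtain B where B: "ereal B \<le> v b"
      by (metis ereal_less_eq(1) order_refl v_0 v_real)
    have diff: "X m - X n = (w m - w n) + (c m - c n) * b" for m n
      by (simp add: wc(1) algebra_simps)
    \<comment> \<open>\<open>coeff_ge\<close> loses only the constant \<open>N\<close>, so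
      \<open>c\<close> inherits the Cauchy property from \<open>X\<close>; afterwards
      \<open>w\<close>, being \<open>X\<close> minus \<open>c * b\<close>, inherits it too.\<close>
    have "v_cauchy v c" unfolding v_cauchy_def
    proof
      fix r :: real
      obtain M where M: "\<And>m n. m \<ge> M \<Longrightarrow> n \<ge> M \<Longrightarrow> ereal (r + N) \<le> v (X m - X n)"
        using X unfolding v_cauchy_def by blast
      have "ereal r \<le> v (c m - c n)" if "m \<ge> M" "n \<ge> M" for m n
        using coeff_ge[of "r + N" "w m - w n" "c m - c n", folded diff, OF M[OF that]]
          fin_gen_diff[OF V(1) R] subring_diff[OF R] wc(2,3) by simp
      then show "\<exists>M. \<forall>m\<ge>M. \<forall>n\<ge>M. ereal r \<le> v (c m - c n)" by blast
    qed
    then obtain C where C: "C \<in> F" "v_converges_to v c C"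
      using F(2) wc(3) unfolding complete_on_def by blast
    have "v_cauchy v w" unfolding v_cauchy_def
    proof
      fix r :: real
      obtain M where M: "\<And>m n. m \<ge> M \<Longrightarrow> n \<ge> M \<Longrightarrow> ereal r \<le> v (X m - X n)"
        using X unfolding v_cauchy_def by blast
      obtain M' where M': "\<And>m n. m \<ge> M' \<Longrightarrow> n \<ge> M' \<Longrightarrow> ereal (r - B) \<le> v (c m - c n)"
        using \<open>v_cauchy v c\<close> unfolding v_cauchy_def by blast
      have "ereal r \<le> v (w m - w n)" if "m \<ge> max M M'" "n \<ge> max M M'" for m n
      proof -
        have "ereal r \<le> v ((c m - c n) * b)"
          using v_ge_mult[OF M' B, of m n] that by simp
        then show ?thesis
          using v_ge_diff[OF M, of m n "(c m - c n) * b"] that diff by simp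
      qed
      then show "\<exists>M. \<forall>m\<ge>M. \<forall>n\<ge>M. ereal r \<le> v (w m - w n)" by blast
    qed
    then obtain W where W: "W \<in> V" "v_converges_to v w W"
      using V(2) wc(2) unfolding complete_on_def by blast
    have "v_converges_to v X (W + C * b)" unfolding v_converges_to_def
    proof
      fix r :: real
      obtain M where M: "\<And>n. n \<ge> M \<Longrightarrow> ereal r \<le> v (w n - W)"
        using W(2) unfolding v_converges_to_def by blast
      obtain M' where M': "\<And>n. n \<ge> M' \<Longrightarrow> ereal (r - B) \<le> v (c n - C)"
        using C(2) unfolding v_converges_to_def by blast
      have "ereal r \<le> v (X n - (W + C * b))" if "n \<ge> max M M'" for n
      proof -
        have eq: "X n - (W + C * b) = (w n - W) + (c n - C) * b"
          by (simp add: wc(1) algebra_simps)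
        show ?thesis
          unfolding eq using v_ge_mult[OF M' B, of n] M[of n] that by (intro v_ge_add) auto
      qed
      then show "\<exists>M. \<forall>n\<ge>M. ereal r \<le> v (X n - (W + C * b))" by blast
    qed
    then show "\<exists>L\<in>{w + c * b | w c. w \<in> V \<and> c \<in> F}. v_converges_to v X L"
      using W(1) C(1) by blast
  qed
qed

lemma complete_on_fin_gen:
  assumes "is_subfield F" "complete_on F" "fin_gen F V"
  shows "complete_on V"
  using assms(3)
proof induction
  case fin_gen_zero
  show ?case unfolding complete_on_def
    by (auto simp: v_converges_to_def v_0)
next
  case (fin_gen_insert V b)
  then show ?case using complete_on_insert[OF assms(1,2)] by blast
qed

text \<open>Picard iteration from \<open>y\<close>. The map is assumed to contract only between
  integral points that are already \<open>\<delta>\<close>-close; by the ultrametric inequality the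
  iterates never leave the \<open>\<delta>\<close>-ball around \<open>y\<close>, all of whose points
  are integral.\<close>

lemma contraction_fixpoint:
  assumes V: "complete_on V" and maps: "\<And>x. x \<in> V \<Longrightarrow> \<phi> x \<in> V"
    and contr: "\<And>x y s. 0 \<le> v x \<Longrightarrow> 0 \<le> v y \<Longrightarrow> \<delta> \<le> s \<Longrightarrow> ereal s \<le> v (x - y) \<Longrightarrow>
          ereal (s + 1) \<le> v (\<phi> x - \<phi> y)"
    and "\<delta> \<ge> 0" and y: "y \<in> V" "0 \<le> v y" and start: "ereal \<delta> \<le> v (\<phi> y - y)"
  shows "\<exists>x\<in>V. \<phi> x = x \<and> ereal \<delta> \<le> v (x - y)"
proof -
  define X where "X n = (\<phi> ^^ n) y" for n
  have X0: "X 0 = y" and XS: "X (Suc n) = \<phi> (X n)" for n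
    by (simp_all add: X_def)
  have XV: "X n \<in> V" for n
    by (induction n) (auto simp: X0 XS y maps)
  have v_0_mono: "0 \<le> v x" if "ereal \<delta> \<le> v (x - y)" for x
  proof -
    have "0 \<le> v (x - y)" using that \<open>\<delta> \<ge> 0\<close>
      by (metis ereal_less_eq(5) order_trans)
    then show ?thesis using v_ge_add[of 0 "x - y" y] y(2) by simp
  qed
  \<comment> \<open>Both invariants are needed together: the first makes \<open>contr\<close>
    applicable, the second makes the increments tend to 0.\<close>
  have step: "ereal \<delta> \<le> v (X n - y) \<and> ereal (\<delta> + real n) \<le> v (X (Suc n) - X n)" for n
  proof (induction n)
    case 0
    then show ?case using start by (simp add: X0 XS v_0)
  next
    case (Suc n)
    have "ereal \<delta> \<le> v (X (Suc n) - X n)"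
      using Suc by (meson ereal_less_eq(3) le_add_same_cancel1 of_nat_0_le_iff order_trans)
    then have *: "ereal \<delta> \<le> v (X (Suc n) - y)"
      using Suc v_ge_trans by blast
    have "ereal (\<delta> + real n + 1) \<le> v (\<phi> (X (Suc n)) - \<phi> (X n))"
      using Suc * by (intro contr v_0_mono) auto
    then show ?case using * by (simp add: XS algebra_simps)
  qed
  have tail: "ereal (\<delta> + real n) \<le> v (X (n + m) - X n)" for n m
  proof (induction m)
    case (Suc m)
    have "ereal (\<delta> + real n) \<le> ereal (\<delta> + real (n + m))" by simp
    then have "ereal (\<delta> + real n) \<le> v (X (Suc (n + m)) - X (n + m))"
      using step[of "n + m"] order_trans by blast
    then show ?case using Suc v_ge_trans by auto
  qed (simp add: v_0)
  have "v_cauchy v X" unfolding v_cauchy_def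
  proof
    fix N :: real
    have "ereal N \<le> v (X m - X (nat \<lceil>N\<rceil>))" if "m \<ge> nat \<lceil>N\<rceil>" for m
    proof -
      have "ereal N \<le> ereal (\<delta> + real (nat \<lceil>N\<rceil>))"
        using \<open>\<delta> \<ge> 0\<close> by simp linarith
      also have "\<dots> \<le> v (X m - X (nat \<lceil>N\<rceil>))"
        using tail[of "nat \<lceil>N\<rceil>" "m - nat \<lceil>N\<rceil>"] le_add_diff_inverse[OF that] by simp
      finally show ?thesis .
    qed
    then have "\<forall>m\<ge>nat \<lceil>N\<rceil>. \<forall>n\<ge>nat \<lceil>N\<rceil>. ereal N \<le> v (X m - X n)"
      using v_diff_commute v_ge_trans by metis
    then show "\<exists>M. \<forall>m\<ge>M. \<forall>n\<ge>M. ereal N \<le> v (X m - X n)" by blast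
  qed
  then obtain x where x: "x \<in> V" "v_converges_to v X x"
    using V XV unfolding complete_on_def by blast
  have near: "\<exists>M. \<forall>n\<ge>M. ereal N \<le> v (X n - x)" for N
    using x(2) unfolding v_converges_to_def by blast
  have xy: "ereal \<delta> \<le> v (x - y)"
    using near[of \<delta>] step v_ge_trans v_diff_commute by (metis order_refl)
  have "ereal (real N) \<le> v (\<phi> x - x)" for N
  proof -
    \<comment> \<open>The bound is raised to \<open>max \<delta> (real N)\<close> because
      \<open>contr\<close> accepts only distances of valuation at least
      \<open>\<delta>\<close>.\<close>
    obtain M where M: "\<And>n. n \<ge> M \<Longrightarrow> ereal (max \<delta> (real N)) \<le> v (X n - x)"
      using near by blast
    have "ereal (max \<delta> (real N) + 1) \<le> v (\<phi> x - \<phi> (X M))"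
      using M[of M] step[of M] xy by (intro contr v_0_mono) (auto simp: v_diff_commute)
    moreover have "ereal (real N) \<le> ereal (max \<delta> (real N) + 1)" by simp
    ultimately have "ereal (real N) \<le> v (\<phi> x - X (Suc M))"
      unfolding XS using order_trans by blast
    moreover have "ereal (real N) \<le> v (X (Suc M) - x)"
      using M[of "Suc M"] by (meson ereal_less_eq(3) max.cobounded2 le_SucI order_refl order_trans)
    ultimately show ?thesis using v_ge_trans by blast
  qed
  then have "\<phi> x = x" using v_unbounded_imp_zero[of "\<phi> x - x"] by simp
  then show ?thesis using x(1) xy by blast
qed

text \<open>Expand \<open>(t + y) ^ p\<close> with \<open>t = x - y\<close>. The mixed terms gain 1
  from a binomial coefficient divisible by p. The last term \<open>t ^ p\<close> gains
  \<open>(p - 1) s\<close>, which is at least 1 because \<open>p - 1 >= 3\<close> and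
  \<open>s >= 1/3\<close>.\<close>

lemma v_pow_prime_diff:
  assumes "prime p" "p > 3" "v (of_nat p) = 1"
    and "0 \<le> v x" "0 \<le> v y" "1 / 3 \<le> s" "ereal s \<le> v (x - y)"
  shows "ereal (s + 1) \<le> v (x ^ p - y ^ p)"
proof -
  define t where "t = x - y"
  have t: "ereal s \<le> v t" "0 \<le> v t"
    using assms(6,7) by (auto simp: t_def intro: order_trans[of 0 "ereal s"])
  have "x ^ p = (t + y) ^ p" by (simp add: t_def)
  also have "\<dots> = (\<Sum>i\<le>p. of_nat (p choose i) * t ^ i * y ^ (p - i))"
    by (rule binomial_ring)
  also have "{..p} = insert 0 {1..p}" by auto
  finally have eq: "x ^ p - y ^ p = (\<Sum>i=1..p. of_nat (p choose i) * t ^ i * y ^ (p - i))"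
    by simp
  have "ereal (s + 1) \<le> v (of_nat (p choose i) * t ^ i * y ^ (p - i))" if i: "i \<in> {1..p}" for i
  proof (rule v_ge_mult0)
    show "0 \<le> v (y ^ (p - i))" using assms(5) by (rule v_ge_power0)
    show "ereal (s + 1) \<le> v (of_nat (p choose i) * t ^ i)"
    proof (cases "i = p")
      case True
      have "s + 1 \<le> real p * s"
        using mult_mono[of 3 "real p - 1" "1 / 3" s] assms(2,6) by (simp add: algebra_simps)
      then show ?thesis
        using v_ge_power[OF t(1), of p] True by (simp add: order_trans[rotated])
    next
      case False
      then have "p dvd p choose i"
        using i assms(1) by (intro dvd_choose_prime) auto
      then obtain m where m: "p choose i = p * m" ..
      have "ereal 1 \<le> v (of_nat (p choose i))"
        using v_ge_mult0[OF _ v_of_nat, of "ereal 1" "of_nat p" m] assms(3)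
        by (simp add: m one_ereal_def)
      moreover have "ereal s \<le> v (t ^ i)"
        using v_ge_mult0[OF t(1) v_ge_power0[OF t(2), of "i - 1"]] i
        by (simp flip: power_Suc)
      ultimately show ?thesis
        using v_ge_mult by (metis add.commute)
    qed
  qed
  then show ?thesis unfolding eq by (rule v_ge_sum)
qed

lemma v_pow_prime_power_diff:
  assumes "prime p" "p > 3" "v (of_nat p) = 1"
    and "0 \<le> v x" "0 \<le> v y" "1 / 3 \<le> s" "ereal s \<le> v (x - y)"
  shows "ereal (s + real m) \<le> v (x ^ p ^ m - y ^ p ^ m)"
proof (induction m)
  case 0
  then show ?case using assms(7) by simp
next
  case (Suc m)
  have "ereal (s + real m + 1) \<le> v ((x ^ p ^ m) ^ p - (y ^ p ^ m) ^ p)"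
    using assms(1-6) Suc by (intro v_pow_prime_diff v_ge_power0) auto
  then show ?case by (simp add: algebra_simps flip: power_mult)
qed

end

section \<open>The polynomials \<open>g\<^sub>k\<close>\<close>

lemma poly_g_poly:
  "poly (g_poly p k a \<pi>) x = x ^ p ^ (2*k) + (\<Sum>n=1..k. (-1) ^ n * of_nat p ^ n *
     (x ^ p ^ (2*k - 2*n) + a * \<pi>\<^sup>2 * x ^ p ^ (2*k + 1 - 2*n)))"
  by (simp add: g_poly_def poly_sum poly_monom algebra_simps)

text \<open>The summand \<open>n = 0\<close> is the leading monomial, and the parameter 0 removes
  \<open>\<pi>\<close>; both polynomials thus belong to one family.\<close>

lemma g_inf_poly_eq: "g_inf_poly p k = g_poly p k 0 \<pi>"
  by (simp add: g_inf_poly_def g_poly_def sum.atLeast_Suc_atMost)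

locale g_poly_setting = valued +
  fixes p k :: nat and \<pi> :: 'a
  assumes p: "prime p" "p > 3" "v (of_nat p) = 1" and k: "k \<ge> 1"
    and v_pi: "ereal (1 / 3) \<le> v (\<pi>\<^sup>2)"
begin

definition c :: "nat \<Rightarrow> 'a" where "c n = (-1) ^ n * of_nat p ^ n"

abbreviation g :: "'a \<Rightarrow> 'a \<Rightarrow> 'a" where "g a \<equiv> poly (g_poly p k a \<pi>)"

text \<open>A Newton step with the derivative frozen at its value at 0: \<open>c k\<close> is the
  coefficient of x in \<open>g_poly p k a \<pi>\<close>.\<close>

definition \<phi> :: "'a \<Rightarrow> 'a \<Rightarrow> 'a" where "\<phi> a x = x - g a x * inverse (c k)"

lemma g_eq: "g a x = x ^ p ^ (2*k) +
    (\<Sum>n=1..k. c n * (x ^ p ^ (2*k - 2*n) + a * \<pi>\<^sup>2 * x ^ p ^ (2*k + 1 - 2*n)))"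
  by (simp add: poly_g_poly c_def)

lemma v_c: "v (c n) = ereal (real n)"
  using v_power[of "-1" 0 n] v_power[of "of_nat p" 1 n] p(3) v_minus_1
  by (simp add: c_def v_mult zero_ereal_def one_ereal_def)

lemma c_neq_0: "c n \<noteq> 0"
  using v_c[of n] v_0 by auto

lemma \<phi>_fixed_iff: "\<phi> a x = x \<longleftrightarrow> g a x = 0"
  using c_neq_0[of k] by (auto simp: \<phi>_def)

text \<open>The polynomial is monic and its other coefficients have valuation at least 1. Dividing
  the equation by the leading power of a non-integral root would give \<open>1 = - S\<close> with
  \<open>S\<close> of positive valuation.\<close>

lemma root_integral:
  assumes a: "0 \<le> v a" and root: "g a x = 0"
  shows "0 \<le> v x"
proof (rule ccontr)
  assume neg: "\<not> 0 \<le> v x"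
  then have "x \<noteq> 0" using v_0 by auto
  define y where "y = inverse x"
  obtain r where r: "v x = ereal r" using v_real \<open>x \<noteq> 0\<close> by blast
  then have y: "0 \<le> v y" using neg v_inverse[OF r] by (simp add: y_def)
  have cancel: "y ^ p ^ (2*k) * x ^ p ^ j = y ^ (p ^ (2*k) - p ^ j)" if "j \<le> 2*k" for j
  proof -
    have "p ^ j \<le> p ^ (2*k)" using that p(2) by (intro power_increasing) auto
    then have "y ^ p ^ (2*k) = y ^ (p ^ (2*k) - p ^ j) * y ^ p ^ j"
      by (simp flip: power_add)
    moreover have "y ^ p ^ j * x ^ p ^ j = 1"
      using \<open>x \<noteq> 0\<close> by (simp add: y_def flip: power_mult_distrib)
    ultimately show ?thesis by (simp add: mult.assoc)
  qed
  define S where "S = (\<Sum>n=1..k. c n * (y ^ (p ^ (2*k) - p ^ (2*k - 2*n)) +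
      a * \<pi>\<^sup>2 * y ^ (p ^ (2*k) - p ^ (2*k + 1 - 2*n))))"
  have "0 = y ^ p ^ (2*k) * g a x" using root by simp
  also have "\<dots> = y ^ p ^ (2*k) * x ^ p ^ (2*k) + (\<Sum>n=1..k. c n *
      (y ^ p ^ (2*k) * x ^ p ^ (2*k - 2*n) +
       a * \<pi>\<^sup>2 * (y ^ p ^ (2*k) * x ^ p ^ (2*k + 1 - 2*n))))"
    unfolding g_eq distrib_left sum_distrib_left by (simp add: mult_ac)
  also have "\<dots> = 1 + S"
    unfolding S_def using cancel by (intro arg_cong2[of _ _ _ _ "(+)"] sum.cong) auto
  finally have "1 = - S" by (simp add: eq_neg_iff_add_eq_0)
  moreover have "ereal 1 \<le> v S"
    unfolding S_def
  proof (intro v_ge_sum v_ge_mult0)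
    fix n assume n: "n \<in> {1..k}"
    show "ereal 1 \<le> v (c n)" using n by (simp add: v_c)
    have "0 \<le> v (\<pi>\<^sup>2)" using v_pi by (auto intro: order_trans[of 0 "ereal (1/3)"])
    then have "0 \<le> v (a * \<pi>\<^sup>2)" using a by (intro v_ge_mult0)
    then show "0 \<le> v (y ^ (p ^ (2*k) - p ^ (2*k - 2*n)) +
        a * \<pi>\<^sup>2 * y ^ (p ^ (2*k) - p ^ (2*k + 1 - 2*n)))"
      by (rule v_ge_add[OF v_ge_power0[OF y] v_ge_mult0[OF _ v_ge_power0[OF y]]])
  qed
  ultimately have "ereal 1 \<le> v 1" by (metis v_minus)
  then show False by (simp add: v_1)
qed

text \<open>The linear term of \<open>g a\<close> contributes exactly \<open>c k * (x - y)\<close>,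
  which cancels the identity part of \<open>\<phi> a\<close>. Every remaining term beats
  \<open>c k\<close> by at least \<open>s + 1\<close>.\<close>

lemma \<phi>_contracts:
  assumes a: "ereal (real k - 1) \<le> v a"
    and "0 \<le> v x" "0 \<le> v y" "1 / 3 \<le> s" "ereal s \<le> v (x - y)"
  shows "ereal (s + 1) \<le> v (\<phi> a x - \<phi> a y)"
proof -
  define d where "d m = x ^ p ^ m - y ^ p ^ m" for m
  have d: "ereal (s + real m) \<le> v (d m)" for m
    unfolding d_def using v_pow_prime_power_diff p assms(2-5) by blast
  define E where "E = d (2*k) + (\<Sum>n\<in>{1..<k}. c n * d (2*k - 2*n)) +
      (\<Sum>n=1..k. c n * (a * \<pi>\<^sup>2 * d (2*k + 1 - 2*n)))"
  have "{1..k} = insert k {1..<k}" using k by auto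
  then have split: "(\<Sum>n=1..k. c n * d (2*k - 2*n)) =
      c k * (x - y) + (\<Sum>n\<in>{1..<k}. c n * d (2*k - 2*n))"
    by (simp add: d_def)
  have "g a x - g a y = d (2*k) + (\<Sum>n=1..k. c n * d (2*k - 2*n)) +
      (\<Sum>n=1..k. c n * (a * \<pi>\<^sup>2 * d (2*k + 1 - 2*n)))"
    unfolding g_eq d_def by (simp add: algebra_simps sum.distrib sum_subtractf)
  then have "g a x - g a y = c k * (x - y) + E"
    unfolding split E_def by simp
  moreover have "\<phi> a x - \<phi> a y = (x - y) - (g a x - g a y) * inverse (c k)"
    by (simp add: \<phi>_def algebra_simps)
  ultimately have eq: "\<phi> a x - \<phi> a y = - (E * inverse (c k))"
    using c_neq_0[of k] by (simp add: field_simps)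
  \<comment> \<open>The three kinds of terms have valuation at least \<open>s + 2k\<close>,
    \<open>s + 2k - n\<close> with \<open>n < k\<close>, and \<open>s + 3k - n + 1/3\<close> with
    \<open>n <= k\<close>.\<close>
  have "ereal (s + 1 + real k) \<le> v E"
    unfolding E_def
  proof (intro v_ge_add v_ge_sum)
    show "ereal (s + 1 + real k) \<le> v (d (2*k))"
      using k by (intro order_trans[OF _ d]) simp
    show "ereal (s + 1 + real k) \<le> v (c n * d (2*k - 2*n))" if "n \<in> {1..<k}" for n
      using that v_c[of n]
      by (intro order_trans[OF _ v_ge_mult[OF _ d, of "real n"]]) (auto simp: of_nat_diff)
    show "ereal (s + 1 + real k) \<le> v (c n * (a * \<pi>\<^sup>2 * d (2*k + 1 - 2*n)))"
      if "n \<in> {1..k}" for n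
      using that v_c[of n]
      by (intro order_trans[OF _ v_ge_mult[OF _ v_ge_mult[OF v_ge_mult[OF a v_pi] d], of "real n"]])
        (auto simp: of_nat_diff)
  qed
  then have "ereal (s + 1 + real k + - real k) \<le> v (E * inverse (c k))"
    using v_inverse[OF v_c, of k] by (intro v_ge_mult) auto
  then show ?thesis unfolding eq by (simp add: v_minus)
qed

text \<open>The pure powers cancel, and the worst remaining summand, \<open>n = 1\<close>, has
  valuation at least \<open>1 + (k - 1) + 1/3\<close>. After division by \<open>c k\<close> the
  surplus 1/3 is exactly the closeness that the contraction requires.\<close>

lemma v_g_diff:
  assumes a: "ereal (real k - 1) \<le> v a" and b: "ereal (real k - 1) \<le> v b" and x: "0 \<le> v x"
  shows "ereal (real k + 1 / 3) \<le> v (g a x - g b x)"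
proof -
  have "g a x - g b x = (\<Sum>n=1..k. c n * ((a - b) * \<pi>\<^sup>2 * x ^ p ^ (2*k + 1 - 2*n)))"
    unfolding g_eq by (simp add: algebra_simps sum.distrib flip: sum_subtractf)
  also have "ereal (real k + 1 / 3) \<le> v \<dots>"
  proof (rule v_ge_sum)
    fix n assume n: "n \<in> {1..k}"
    have *: "ereal (real k - 1 + 1 / 3) \<le> v ((a - b) * \<pi>\<^sup>2 * x ^ p ^ (2*k + 1 - 2*n))"
      using v_ge_diff[OF a b] v_pi x by (intro v_ge_mult0[OF v_ge_mult] v_ge_power0)
    then show "ereal (real k + 1 / 3) \<le> v (c n * ((a - b) * \<pi>\<^sup>2 * x ^ p ^ (2*k + 1 - 2*n)))"
      using n by (intro order_trans[OF _ v_ge_mult[OF eq_refl[OF v_c[symmetric]] *]]) auto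
  qed
  finally show ?thesis .
qed

text \<open>All exponents other than the leading \<open>p ^ (2*k)\<close> are powers
  \<open>p ^ j\<close> with \<open>j < 2*k\<close>, so \<open>y\<close> satisfies a monic equation
  over \<open>R\<close> and \<open>fin_gen_adjoin\<close> applies.\<close>

lemma fin_gen_adjoin_root:
  assumes F: "is_subring F" and R: "is_subring R" "fin_gen F R" "a \<in> R" "\<pi> \<in> R" and y: "g a y = 0"
  shows "fin_gen F (adjoin R y)"
proof (rule fin_gen_adjoin[OF R(1,2)])
  define r where "r = monom 1 (p ^ (2*k)) - g_poly p k a \<pi>"
  have r: "r = - (\<Sum>n=1..k. smult ((-1) ^ n * of_nat p ^ n)
        (monom 1 (p ^ (2*k - 2*n)) + smult (a * \<pi>^2) (monom 1 (p ^ (2*k + 1 - 2*n)))))"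
    by (simp add: r_def g_poly_def)
  have pows: "(-1) ^ n * of_nat p ^ n \<in> R" for n
    using R(1) by (intro subring_mult subring_power subring_uminus subring_1 subring_of_nat)
  have api: "a * \<pi>\<^sup>2 \<in> R"
    using R by (intro subring_mult subring_power)
  have ind: "(if P then 1 else 0) \<in> R" for P
    using subring_0[OF R(1)] subring_1[OF R(1)] by simp
  show "coeff r i \<in> R" for i
    unfolding r coeff_minus coeff_sum coeff_smult coeff_add coeff_monom
    by (rule subring_uminus[OF R(1) subring_sum[OF R(1) subring_mult[OF R(1) pows
          subring_add[OF R(1) ind subring_mult[OF R(1) api ind]]]]])
  show "coeff r i = 0" if "i \<ge> p ^ (2*k)" for i
  proof -
    have "p ^ j < p ^ (2*k)" if "j < 2*k" for j
      using that p(2) by (intro power_strict_increasing) auto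
    then have ne: "p ^ j \<noteq> i" if "j < 2*k" for j
      using that \<open>i \<ge> p ^ (2*k)\<close> by fastforce
    have "p ^ (2*k - 2*n) \<noteq> i" "p ^ (2*k + 1 - 2*n) \<noteq> i" if "n \<in> {1..k}" for n
      using that by (intro ne; auto)+
    then show ?thesis
      unfolding r coeff_minus coeff_sum coeff_smult coeff_add coeff_monom
      by simp
  qed
  show "y ^ p ^ (2*k) = poly r y"
    using y by (simp add: r_def poly_monom)
qed

section \<open>Transfer of roots between two parameters\<close>

context
  fixes F :: "'a set" and e :: nat
  assumes F: "is_subfield F" "complete_on F"
    and pi: "\<pi> ^ e + of_nat p = 0" "e > 0"
begin

text \<open>Besides closeness, the point is that the new root lies in a ring generated by the old
  one. That ring contains \<open>\<pi>\<close> and \<open>a\<close>, so it is stable under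
  \<open>\<phi> a\<close>, and it is complete because it is finitely generated over
  \<open>F\<close>.\<close>

lemma near_root_in_adjoin:
  assumes a: "a \<in> F" "ereal (real k - 1) \<le> v a" and b: "b \<in> F" "ereal (real k - 1) \<le> v b"
    and y: "g b y = 0"
  shows "\<exists>x \<in> adjoin (adjoin F \<pi>) y. g a x = 0 \<and> ereal (1 / 3) \<le> v (x - y)"
proof -
  note RF = is_subring_subfield[OF F(1)]
  define R where "R = adjoin F \<pi>"
  define T where "T = adjoin R y"
  have R: "is_subring R" unfolding R_def by (rule is_subring_adjoin[OF RF])
  have T: "is_subring T" unfolding T_def by (rule is_subring_adjoin[OF R])
  have "fin_gen F R" unfolding R_def
  proof (rule fin_gen_adjoin[OF RF fin_gen_self])
    show "coeff [:- of_nat p:] i \<in> F" for i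
      using RF by (cases i) (auto intro: subring_0 subring_uminus subring_of_nat)
    show "coeff [:- of_nat p :: 'a:] i = 0" if "i \<ge> e" for i
      using that pi(2) by (cases i) auto
    show "\<pi> ^ e = poly [:- of_nat p:] \<pi>"
      using pi(1) by (simp add: eq_neg_iff_add_eq_0)
  qed
  have FR: "F \<subseteq> R" unfolding R_def by (rule subset_adjoin[OF RF])
  have RT: "R \<subseteq> T" unfolding T_def by (rule subset_adjoin[OF R])
  have pi_R: "\<pi> \<in> R" unfolding R_def by (rule in_adjoin[OF RF])
  have y_T: "y \<in> T" unfolding T_def by (rule in_adjoin[OF R])
  have "fin_gen F T"
    unfolding T_def using b(1) FR y
    by (intro fin_gen_adjoin_root[OF RF R \<open>fin_gen F R\<close> _ pi_R]) auto
  then have "complete_on T" by (rule complete_on_fin_gen[OF F])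
  have "0 \<le> ereal (real k - 1)" using k by simp
  then have b0: "0 \<le> v b" using b(2) order_trans by blast
  have maps: "\<phi> a x \<in> T" if "x \<in> T" for x
  proof -
    have "c k \<in> F" unfolding c_def
      using RF by (intro subring_mult subring_power subring_uminus subring_1 subring_of_nat)
    then have "inverse (c k) \<in> T" using F(1) FR RT by (auto simp: is_subfield_def)
    moreover have "c n \<in> T" for n unfolding c_def
      using T by (intro subring_mult subring_power subring_uminus subring_1 subring_of_nat)
    moreover have "a \<in> T" "\<pi> \<in> T" using a(1) FR RT pi_R by auto
    ultimately show ?thesis
      unfolding \<phi>_def g_eq using that T
      by (intro subring_diff subring_add subring_mult subring_sum subring_power)
  qed
  have y0: "0 \<le> v y" by (rule root_integral[OF b0 y])
  have "ereal (real k + 1 / 3 + - real k) \<le> v ((g a y - g b y) * inverse (c k))"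
    using v_g_diff[OF a(2) b(2) y0] v_inverse[OF v_c, of k] by (intro v_ge_mult) auto
  then have "ereal (1 / 3) \<le> v (\<phi> a y - y)"
    by (simp add: \<phi>_def y v_minus)
  then have "\<exists>x\<in>T. \<phi> a x = x \<and> ereal (1 / 3) \<le> v (x - y)"
    using \<phi>_contracts[OF a(2)]
    by (intro contraction_fixpoint \<open>complete_on T\<close> maps y_T y0) auto
  then show ?thesis by (simp add: \<phi>_fixed_iff T_def R_def)
qed

text \<open>A round trip: from a root \<open>x\<close> of \<open>g a\<close> to a nearby root
  \<open>y\<close> of \<open>g b\<close>, and back to a root \<open>x'\<close> of \<open>g a\<close>
  in the ring generated by \<open>y\<close>, which lies in \<open>L\<close>. Both \<open>x\<close>
  and \<open>x'\<close> are close to \<open>y\<close>, and the contraction leaves room for only one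
  such root.\<close>

lemma roots_in_field:
  assumes a: "a \<in> F" "ereal (real k - 1) \<le> v a" and b: "b \<in> F" "ereal (real k - 1) \<le> v b"
    and L: "is_subfield L" "F \<subseteq> L" "\<pi> \<in> L" "{y. g b y = 0} \<subseteq> L"
  shows "{x. g a x = 0} \<subseteq> L"
proof
  fix x assume "x \<in> {x. g a x = 0}"
  then have x: "g a x = 0" by simp
  obtain y where y: "g b y = 0" "ereal (1 / 3) \<le> v (y - x)"
    using near_root_in_adjoin[OF b a x] by blast
  obtain x' where x': "x' \<in> adjoin (adjoin F \<pi>) y" "g a x' = 0" "ereal (1 / 3) \<le> v (x' - y)"
    using near_root_in_adjoin[OF a b y(1)] by blast
  have "0 \<le> ereal (real k - 1)" using k by simp
  then have "0 \<le> v a" using a(2) order_trans by blast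
  then have int: "0 \<le> v x" "0 \<le> v x'" using root_integral x x'(2) by auto
  have near: "ereal (1 / 3) \<le> v (x' - x)" using x'(3) y(2) by (rule v_ge_trans)
  have "x' = x"
  proof (rule ccontr)
    assume "x' \<noteq> x"
    then obtain s where s: "v (x' - x) = ereal s" using v_real[of "x' - x"] by auto
    \<comment> \<open>Both points are fixed by \<open>\<phi> a\<close>, so this bound reads
      \<open>s + 1 <= s\<close>.\<close>
    have "ereal (s + 1) \<le> v (\<phi> a x' - \<phi> a x)"
      using \<phi>_contracts[OF a(2) int(2,1), of s] near s by simp
    then show False using x x'(2) s \<phi>_fixed_iff[of a x] \<phi>_fixed_iff[of a x'] by simp
  qed
  moreover have "adjoin (adjoin F \<pi>) y \<subseteq> L"
    using L y(1) by (intro adjoin_subset is_subring_subfield) auto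
  ultimately show "x \<in> L" using x'(1) by blast
qed

end

end

section \<open>Generated fields and the comparison of the splitting fields\<close>

lemma is_subfield_gen_field: "is_subfield (gen_field S)"
  by (auto simp: gen_field_def is_subfield_def)

lemma subset_gen_field: "S \<subseteq> gen_field S"
  by (auto simp: gen_field_def)

lemma gen_field_subset: "is_subfield F \<Longrightarrow> S \<subseteq> F \<Longrightarrow> gen_field S \<subseteq> F"
  by (auto simp: gen_field_def)

theorem mainTheorem18:
  fixes p e k :: nat and v :: "'a::field_char_0 \<Rightarrow> ereal" and Qp :: "'a set"
    and \<pi> \<zeta> :: 'a and \<alpha> :: "'a option"
  assumes "padic_closure p v Qp"
    and "prime p" and "p > 3"
    and "e \<in> {3, 4, 6}" and "e dvd p + 1"
    and "k \<ge> 1"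
    and "\<pi> ^ e + of_nat p = 0"
    and "primitive_root_of_unity e \<zeta>"
    and "set_option \<alpha> \<subseteq> Qp"
    and "v (inv_P1 \<alpha>) \<ge> ereal (max 0 (real k - 1))"
  shows "splitting_field_over (gen_field (Qp \<union> {\<pi>, \<zeta>})) (g_poly p k (inv_P1 \<alpha>) \<pi>)
       = splitting_field_over (gen_field (Qp \<union> {\<pi>, \<zeta>})) (g_inf_poly p k)"
proof -
  interpret valued v
    using assms(1) by unfold_locales (simp add: padic_closure_def)
  have vp: "v (of_nat p) = 1" and Qp: "is_subfield Qp" "complete_on Qp"
    using assms(1) by (auto simp: padic_closure_def complete_on_def)
  have e: "0 < e" "e \<le> 6" using assms(4) by auto
  \<comment> \<open>From \<open>\<pi> ^ e = - p\<close> one gets v(pi) = 1/e, so v(pi^2) = 2/e; the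
    constant 1/3 is the case e = 6.\<close>
  have v_pi: "ereal (1 / 3) \<le> v (\<pi>\<^sup>2)"
  proof -
    have "\<pi> ^ e = - of_nat p" using assms(7) by (simp add: eq_neg_iff_add_eq_0)
    then have vpe: "v (\<pi> ^ e) = ereal 1" by (simp add: v_minus vp one_ereal_def)
    then have "\<pi> \<noteq> 0" using v_0 e by (auto simp: power_0_left)
    then obtain r where r: "v \<pi> = ereal r" using v_real by blast
    then have "real e * r = 1" using v_power[OF r, of e] vpe by simp
    moreover from this have "0 < r"
      using zero_less_mult_iff[of "real e" r] by auto
    then have "real e * r \<le> 6 * r"
      using e by (intro mult_right_mono) auto
    ultimately show ?thesis using v_power[OF r, of 2] by simp
  qed
  interpret g_poly_setting v p k \<pi>
    using assms(2,3,6) vp v_pi by unfold_locales auto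
  define a where "a = inv_P1 \<alpha>"
  \<comment> \<open>\<open>None\<close> gives the parameter 0. So does \<open>Some 0\<close>, since
    \<open>inverse 0 = 0\<close>; in both cases the first polynomial is already the second
    one.\<close>
  have a: "a \<in> Qp" "ereal (real k - 1) \<le> v a"
    using assms(9,10) Qp(1) order_trans[of "ereal (real k - 1)" "ereal (max 0 (real k - 1))"]
    by (auto simp: a_def inv_P1_def is_subfield_def split: option.splits)
  have z: "0 \<in> Qp" "ereal (real k - 1) \<le> v 0"
    using Qp(1) by (auto simp: is_subfield_def v_0)
  define K where "K = gen_field (Qp \<union> {\<pi>, \<zeta>})"
  have K: "Qp \<subseteq> K" "\<pi> \<in> K" using subset_gen_field[of "Qp \<union> {\<pi>, \<zeta>}"] by (auto simp: K_def)
  \<comment> \<open>One inclusion for arbitrary admissible parameters; the pairs \<open>a\<close>, 0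
    and 0, \<open>a\<close> then give equality.\<close>
  have "splitting_field_over K (g_poly p k b \<pi>) \<subseteq> splitting_field_over K (g_poly p k b' \<pi>)"
    if "b \<in> Qp" "ereal (real k - 1) \<le> v b" "b' \<in> Qp" "ereal (real k - 1) \<le> v b'" for b b'
  proof -
    define L where "L = splitting_field_over K (g_poly p k b' \<pi>)"
    have L: "is_subfield L" "K \<subseteq> L" "{y. g b' y = 0} \<subseteq> L"
      using subset_gen_field[of "K \<union> {y. g b' y = 0}"] is_subfield_gen_field
      by (auto simp: L_def splitting_field_over_def)
    then have "{x. g b x = 0} \<subseteq> L"
      using roots_in_field[OF Qp assms(7) e(1) that L(1) _ _ L(3)] K by blast
    then show ?thesis
      unfolding L_def[symmetric] splitting_field_over_def[of K "g_poly p k b \<pi>"]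
      using L by (intro gen_field_subset) auto
  qed
  then show ?thesis
    unfolding g_inf_poly_eq[of p k \<pi>] using a z by (fold a_def K_def) blast
qed

end
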